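(* Let $A, B \in \mathcal{K}^d_{kc}$. Then there exists a set $X \in \mathcal{K}^d_{kc}$ such that $X \in A \ominus_e B$; that is, there is $X\in\mathcal{K}^d_{kc}$ with $d_H(A, B\oplus X) = \inf_{Y \in \mathcal{K}^d_{kc}} d_H(A, B \oplus Y)$.
   Context: $\mathcal{K}^d_{kc}$ is the set of all nonempty compact convex subsets of Euclidean space $\mathbb{R}^d$ (with norm $\|\cdot\|$). Minkowski sum: $A\oplus B=\{a+b: a\in A, b\in B\}$. Hausdorff distance: $d_H(A,B)=\max\{\sup_{a\in A}\inf_{b\in B}\|a-b\|,\ \sup_{b\in B}\inf_{a\in A}\|a-b\|\}$. The extended set difference of $A,B\in\mathcal{K}^d_{kc}$ is the collection of minimizers $A\ominus_e B=\{X\in\mathcal{K}^d_{kc}: d_H(A,B\oplus X)=\inf_{Y\in\mathcal{K}^d_{kc}} d_H(A,B\oplus Y)\}$. *)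

theory Defs
  imports "HOL-Analysis.Analysis" "HOL-Library.Set_Algebras"
begin

definition Kkc :: "(real ^ 'd) set set" where
  "Kkc = {A. A \<noteq> {} \<and> compact A \<and> convex A}"

(* SUP and INF are taken in the reals, so they have the intended value only on
   nonempty bounded sets of numbers. This is the case for nonempty bounded A, B;
   see bdd_above_hausdorff_excess below. *)
definition hausdorff_dist :: "(real ^ 'd) set \<Rightarrow> (real ^ 'd) set \<Rightarrow> real" where
  "hausdorff_dist A B =
    max (SUP a\<in>A. INF b\<in>B. norm (a - b)) (SUP b\<in>B. INF a\<in>A. norm (a - b))"

(* On sets, + is the Minkowski sum of HOL-Library.Set_Algebras. *)
definition ext_set_diff ::
  "(real ^ 'd) set \<Rightarrow> (real ^ 'd) set \<Rightarrow> (real ^ 'd) set set" (infixl \<open>\<ominus>\<^sub>e\<close> 65) where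
  "A \<ominus>\<^sub>e B =
    {X \<in> Kkc. hausdorff_dist A (B + X) = (INF Y\<in>Kkc. hausdorff_dist A (B + Y))}"

lemma Kkc_nonempty: "Kkc \<noteq> {}"
proof -
  have "{0} \<in> Kkc" by (simp add: Kkc_def)
  then show ?thesis by blast
qed

lemma Kkc_plus:
  assumes "A \<in> Kkc" "B \<in> Kkc"
  shows "A + B \<in> Kkc"
proof -
  have "A + B = {x + y | x y. x \<in> A \<and> y \<in> B}"
    by (auto simp: set_plus_def)
  moreover have "compact {x + y | x y. x \<in> A \<and> y \<in> B}"
    using assms by (intro compact_sums) (auto simp: Kkc_def)
  moreover have "convex (A + B)"
    using assms by (intro convex_set_plus) (auto simp: Kkc_def)
  moreover have "A + B \<noteq> {}"
    using assms by (auto simp: Kkc_def set_plus_def)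
  ultimately show ?thesis by (simp add: Kkc_def)
qed

lemma bdd_above_hausdorff_excess:
  fixes A B :: "(real ^ 'd) set"
  assumes "bounded A" "B \<noteq> {}"
  shows "bdd_above ((\<lambda>a. INF b\<in>B. norm (a - b)) ` A)"
proof -
  obtain c where c: "c \<in> B" using assms(2) by blast
  obtain M where M: "\<forall>a\<in>A. norm a \<le> M" using assms(1) by (auto simp: bounded_iff)
  have "(INF b\<in>B. norm (a - b)) \<le> M + norm c" if "a \<in> A" for a
  proof -
    have "(INF b\<in>B. norm (a - b)) \<le> norm (a - c)"
      using c by (intro cINF_lower bdd_belowI[where m = 0]) auto
    also have "\<dots> \<le> norm a + norm c" by (rule norm_triangle_ineq4)
    finally show ?thesis using M that by fastforce
  qed
  then show ?thesis by (intro bdd_aboveI[where M = "M + norm c"]) auto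
qed

lemma hausdorff_dist_nonneg:
  assumes "A \<in> Kkc" "B \<in> Kkc"
  shows "0 \<le> hausdorff_dist A B"
proof -
  have AB: "A \<noteq> {}" "B \<noteq> {}" "bounded A"
    using assms by (auto simp: Kkc_def compact_imp_bounded)
  obtain a where a: "a \<in> A" using AB by blast
  have "0 \<le> (INF b\<in>B. norm (a - b))"
    using AB by (intro cINF_greatest) auto
  also have "\<dots> \<le> (SUP a\<in>A. INF b\<in>B. norm (a - b))"
    using a AB by (intro cSUP_upper bdd_above_hausdorff_excess)
  finally show ?thesis by (simp add: hausdorff_dist_def)
qed

end

theory Submission
  imports Defs
begin

text \<open>
  The two inequalities behind a bound \<open>r\<close> on the distance from \<open>A\<close> to \<open>B + X\<close> pull in different
  directions. That \<open>B + X\<close> stays within \<open>r\<close> of \<open>A\<close> is a condition on the single points of \<open>X\<close>, so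
  there is a largest set \<open>erosion A B r\<close> satisfying it; that \<open>A\<close> stays within \<open>r\<close> of \<open>B + X\<close> only
  becomes easier when \<open>X\<close> grows. Hence, if the bound \<open>r\<close> is attainable at all, it is attained by
  the erosion, which is compact and convex (\<open>erosion_reaches\<close>, \<open>erosion_attains\<close>).

  Let \<open>m\<close> be the infimum. The bounds \<open>r > m\<close> are attainable, and it remains to pass to \<open>r = m\<close>. For
  a point \<open>a\<close> of \<open>A\<close>, those points \<open>x\<close> of the erosion for which \<open>x + B\<close> comes within \<open>r\<close> of \<open>a\<close> form
  compact sets that are nonempty for \<open>r > m\<close> and shrink as \<open>r\<close> decreases to \<open>m\<close>; a point common
  to all of them serves for \<open>r = m\<close> (\<open>erosion_reaches_limit\<close>). So the erosion at \<open>m\<close> is a minimizer.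
\<close>

lemma INF_norm_eq_infdist:
  assumes "S \<noteq> {}"
  shows "(INF s\<in>S. norm (x - s)) = infdist x S"
  using assms by (simp add: infdist_notempty dist_norm)

lemma hausdorff_dist_le_iff:
  assumes "A \<in> Kkc" "B \<in> Kkc"
  shows "hausdorff_dist A B \<le> r \<longleftrightarrow>
    (\<forall>a\<in>A. infdist a B \<le> r) \<and> (\<forall>b\<in>B. infdist b A \<le> r)"
proof -
  have AB: "A \<noteq> {}" "B \<noteq> {}" "bounded A" "bounded B"
    using assms by (auto simp: Kkc_def compact_imp_bounded)
  have "(INF a\<in>A. norm (a - b)) = infdist b A" for b
    using INF_norm_eq_infdist [OF AB(1), of b] by (simp only: norm_minus_commute [of b])
  then have "hausdorff_dist A B = max (SUP a\<in>A. infdist a B) (SUP b\<in>B. infdist b A)"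
    using AB(2) by (simp add: hausdorff_dist_def INF_norm_eq_infdist)
  moreover have "bdd_above ((\<lambda>a. infdist a B) ` A)" "bdd_above ((\<lambda>b. infdist b A) ` B)"
    using bdd_above_hausdorff_excess [of A B] bdd_above_hausdorff_excess [of B A] AB
    by (simp_all add: INF_norm_eq_infdist)
  ultimately show ?thesis
    using AB by (simp add: cSUP_le_iff)
qed

lemma infdist_le_iff_compact:
  fixes S :: "'a::heine_borel set"
  assumes "compact S" "S \<noteq> {}"
  shows "infdist x S \<le> r \<longleftrightarrow> (\<exists>s\<in>S. dist x s \<le> r)"
  using infdist_attains_inf [OF compact_imp_closed [OF assms(1)] assms(2), of x]
  by (metis infdist_le order_trans)

lemma infdist_set_plus_le_iff:
  assumes "B \<in> Kkc" "X \<in> Kkc"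
  shows "infdist a (B + X) \<le> r \<longleftrightarrow> (\<exists>x\<in>X. infdist (a - x) B \<le> r)"
proof -
  have "infdist a (B + X) \<le> r \<longleftrightarrow> (\<exists>s\<in>B + X. dist a s \<le> r)"
    using Kkc_plus [OF assms] by (intro infdist_le_iff_compact) (auto simp: Kkc_def)
  also have "\<dots> \<longleftrightarrow> (\<exists>x\<in>X. \<exists>b\<in>B. dist a (b + x) \<le> r)"
    by (blast intro: set_plus_intro elim: set_plus_elim)
  also have "\<dots> \<longleftrightarrow> (\<exists>x\<in>X. \<exists>b\<in>B. dist (a - x) b \<le> r)"
    by (simp add: dist_norm algebra_simps)
  also have "\<dots> \<longleftrightarrow> (\<exists>x\<in>X. infdist (a - x) B \<le> r)"
    using assms(1) by (simp add: infdist_le_iff_compact Kkc_def)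
  finally show ?thesis .
qed

text \<open>
  For nonempty compact \<open>A\<close> this is the Minkowski difference of the closed \<open>r\<close>-neighbourhood of \<open>A\<close> and \<open>B\<close>.
\<close>

definition erosion :: "'a::real_normed_vector set \<Rightarrow> 'a set \<Rightarrow> real \<Rightarrow> 'a set" where
  "erosion A B r = {x. \<forall>b\<in>B. infdist (b + x) A \<le> r}"

lemma erosion_mono: "r \<le> s \<Longrightarrow> erosion A B r \<subseteq> erosion A B s"
  by (force simp: erosion_def)

text \<open>
  A point \<open>b\<close> of \<open>B\<close> confines \<open>x\<close> to the closed \<open>r\<close>-neighbourhood of \<open>A\<close> translated by \<open>- b\<close>, and that
  neighbourhood inherits compactness and convexity from \<open>A\<close>.
\<close>

lemma erosion_compact_convex:
  fixes A B :: "(real ^ 'd) set"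
  assumes "A \<in> Kkc" "B \<noteq> {}"
  shows "compact (erosion A B r)" "convex (erosion A B r)"
proof -
  have A: "compact A" "A \<noteq> {}" "convex A"
    using assms(1) by (auto simp: Kkc_def)
  have "infdist (b + x) A \<le> r \<longleftrightarrow> x \<in> A + cball (- b) r" for b x
  proof -
    have "infdist (b + x) A \<le> r \<longleftrightarrow> (\<exists>a\<in>A. dist (b + x) a \<le> r)"
      using A by (simp add: infdist_le_iff_compact)
    also have "\<dots> \<longleftrightarrow> (\<exists>a\<in>A. x - a \<in> cball (- b) r)"
    proof -
      have "dist (- b) (x - a) = dist (b + x) a" for a
        using norm_minus_cancel [of "b + x - a"] by (simp add: dist_norm algebra_simps)
      then show ?thesis by simp
    qed
    also have "\<dots> \<longleftrightarrow> x \<in> A + cball (- b) r"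
    proof -
      have "x = a + c \<longleftrightarrow> c = x - a" for a c by (auto simp: algebra_simps)
      then show ?thesis by (simp add: set_plus_def del: mem_cball)
    qed
    finally show ?thesis .
  qed
  then have eq: "erosion A B r = (\<Inter>b\<in>B. A + cball (- b) r)"
    by (auto simp: erosion_def)
  have "A + cball (- b) r = {x + y | x y. x \<in> A \<and> y \<in> cball (- b) r}" for b
    unfolding set_plus_def by blast
  then have "compact (A + cball (- b) r)" for b
    using compact_sums [OF A(1) compact_cball] by simp
  then show "compact (erosion A B r)"
    unfolding eq using assms(2) by (intro compact_Inter) auto
  show "convex (erosion A B r)"
    unfolding eq using A by (intro convex_INT convex_set_plus) auto
qed

text \<open>
  The points that reach \<open>A\<close> make the erosion nonempty, and its very definition keeps \<open>B + erosion A B r\<close>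
  within \<open>r\<close> of \<open>A\<close>; so the hypothesis \<open>reach\<close> is the only half of the distance bound to be checked.
\<close>

lemma erosion_attains:
  fixes A B :: "(real ^ 'd) set"
  assumes "A \<in> Kkc" "B \<in> Kkc"
    and reach: "\<And>a. a \<in> A \<Longrightarrow> \<exists>x\<in>erosion A B r. infdist (a - x) B \<le> r"
  shows "erosion A B r \<in> Kkc" "hausdorff_dist A (B + erosion A B r) \<le> r"
proof -
  have "A \<noteq> {}" "B \<noteq> {}" using assms by (auto simp: Kkc_def)
  then show E: "erosion A B r \<in> Kkc"
    using erosion_compact_convex [OF assms(1), of B r] reach by (auto simp: Kkc_def)
  show "hausdorff_dist A (B + erosion A B r) \<le> r"
    using assms E
    by (auto simp: hausdorff_dist_le_iff Kkc_plus infdist_set_plus_le_iff erosion_def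
        elim!: set_plus_elim)
qed

text \<open>
  Every \<open>X\<close> within the bound \<open>r\<close> lies in the erosion at \<open>r\<close>, so a point of \<open>X\<close> that reaches \<open>a\<close> is
  also a point of the erosion.
\<close>

lemma erosion_reaches:
  fixes A B X :: "(real ^ 'd) set"
  assumes "A \<in> Kkc" "B \<in> Kkc" "X \<in> Kkc" "hausdorff_dist A (B + X) \<le> r" "a \<in> A"
  shows "\<exists>x\<in>erosion A B r. infdist (a - x) B \<le> r"
proof -
  have "infdist a (B + X) \<le> r" and "\<forall>s\<in>B + X. infdist s A \<le> r"
    using assms by (auto simp: hausdorff_dist_le_iff Kkc_plus)
  moreover from this have "X \<subseteq> erosion A B r"
    by (auto simp: erosion_def)
  ultimately show ?thesis
    using assms by (auto simp: infdist_set_plus_le_iff)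
qed

lemma le_of_le_add_inverse_Suc:
  fixes x m :: real
  assumes "\<And>n. x \<le> m + inverse (real (Suc n))"
  shows "x \<le> m"
  using LIMSEQ_inverse_real_of_nat_add [of m] assms by (intro LIMSEQ_le_const) auto

text \<open>
  Both requirements on \<open>x\<close> are closed and weaken as the bound grows; Cantor's intersection theorem
  therefore supplies one \<open>x\<close> for all the bounds \<open>m + 1/(n+1)\<close> at once.
\<close>

lemma erosion_reaches_limit:
  fixes A B :: "(real ^ 'd) set"
  assumes "A \<in> Kkc" "B \<noteq> {}"
    and reach: "\<And>r. m < r \<Longrightarrow> \<exists>x\<in>erosion A B r. infdist (a - x) B \<le> r"
  shows "\<exists>x\<in>erosion A B m. infdist (a - x) B \<le> m"
proof -
  define r where "r n = m + inverse (real (Suc n))" for n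
  define K where "K n = erosion A B (r n) \<inter> {x. infdist (a - x) B \<le> r n}" for n
  have r_antimono: "r n \<le> r k" if "k \<le> n" for k n
    using that by (simp add: r_def field_simps)
  have "compact (K n)" for n
    unfolding K_def using assms(1,2)
    by (intro compact_Int_closed erosion_compact_convex closed_Collect_le continuous_intros)
  moreover have "K n \<noteq> {}" for n
    using reach [of "r n"] by (auto simp: K_def r_def)
  moreover have "K n \<subseteq> K k" if "k \<le> n" for k n
    using erosion_mono [OF r_antimono [OF that], of A B] r_antimono [OF that]
    by (auto simp: K_def)
  ultimately have "\<Inter> (range K) \<noteq> {}"
    by (intro compact_nest)
  then obtain x where x: "\<And>n. x \<in> K n" by auto
  have "infdist (b + x) A \<le> m" if "b \<in> B" for b
  proof (rule le_of_le_add_inverse_Suc)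
    show "infdist (b + x) A \<le> m + inverse (real (Suc n))" for n
      using x [of n] that by (simp add: K_def r_def erosion_def)
  qed
  moreover have "infdist (a - x) B \<le> m"
  proof (rule le_of_le_add_inverse_Suc)
    show "infdist (a - x) B \<le> m + inverse (real (Suc n))" for n
      using x [of n] by (simp add: K_def r_def)
  qed
  ultimately show ?thesis by (auto simp: erosion_def)
qed

theorem theorem1:
  fixes A B :: "(real ^ 'd) set"
  assumes "A \<in> Kkc" and "B \<in> Kkc"
  shows "\<exists>X\<in>Kkc. X \<in> A \<ominus>\<^sub>e B \<and>
    hausdorff_dist A (B + X) = (INF Y\<in>Kkc. hausdorff_dist A (B + Y))"
proof -
  define m where "m = (INF Y\<in>Kkc. hausdorff_dist A (B + Y))"
  let ?E = "erosion A B m"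
  have bdd: "bdd_below ((\<lambda>Y. hausdorff_dist A (B + Y)) ` Kkc)"
    using assms by (intro bdd_belowI [where m = 0]) (auto intro: hausdorff_dist_nonneg Kkc_plus)
  have reach: "\<exists>x\<in>erosion A B r. infdist (a - x) B \<le> r" if "a \<in> A" "m < r" for a r
  proof -
    obtain Y where "Y \<in> Kkc" "hausdorff_dist A (B + Y) < r"
      using \<open>m < r\<close> cINF_less_iff [OF Kkc_nonempty bdd, of r] unfolding m_def by blast
    then show ?thesis
      using \<open>a \<in> A\<close> erosion_reaches [OF assms] by simp
  qed
  have "B \<noteq> {}" using assms(2) by (simp add: Kkc_def)
  then have "\<exists>x\<in>?E. infdist (a - x) B \<le> m" if "a \<in> A" for a
    using erosion_reaches_limit [OF assms(1) _ reach [OF that]] by simp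
  then have E: "?E \<in> Kkc" "hausdorff_dist A (B + ?E) \<le> m"
    by (simp_all add: erosion_attains [OF assms])
  moreover have "m \<le> hausdorff_dist A (B + ?E)"
    using cINF_lower [OF bdd E(1)] by (simp add: m_def)
  ultimately have "hausdorff_dist A (B + ?E) = m" by simp
  with E(1) show ?thesis by (auto simp: ext_set_diff_def m_def)
qed

end
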